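(* Let $(X,d)$ be a (commutative) metric invariant group with identity element $e$. Then the metric space $(\mathcal{K}(X),\oplus,d_\infty)$ is also a (commutative) monoid, having $\gamma(e)=\delta_e$ as identity element and satisfying: (a) $d_\infty(f\oplus g,h\oplus g)\le d_\infty(f,h)$ and $d_\infty(g\oplus f,g\oplus h)\le d_\infty(f,h)$ for all $f,g,h\in\mathcal{K}(X)$; (b) $d_\infty(\delta_x\oplus f,\delta_x\oplus h)=d_\infty(f\oplus\delta_x,h\oplus\delta_x)=d_\infty(f,h)$ for all $f,h\in\mathcal{K}(X)$ and all $x\in X$.
   Context: A group $X$ with a metric $d$ is metric invariant if $d(xy,xz)=d(yx,zx)=d(y,z)$ for all $x,y,z\in X$. A function $f:X\to\mathbb{R}$ is a Katetov map if $|f(x)-f(y)|\le d(x,y)\le f(x)+f(y)$ for all $x,y\in X$. $\mathcal{K}(X)$ is the set of all Katetov maps on $X$, with the metric $d_\infty(f,g)=\sup_{x\in X}|f(x)-g(x)|<+\infty$ and the inf-convolution $(f\oplus g)(x):=\inf\{f(y)+g(z): y,z\in X,\ yz=x\}$. For $x\in X$, $\gamma(x)=\delta_x$ is the function $t\mapsto d(x,t)$. *)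

theory Defs
  imports "HOL-Analysis.Abstract_Metric_Spaces" "HOL-Algebra.Group"
begin

locale metric_invariant_group = group G + Metric_space "carrier G" d
  for G (structure) and d +
  assumes left_invariant:
    "\<lbrakk>x \<in> carrier G; y \<in> carrier G; z \<in> carrier G\<rbrakk> \<Longrightarrow> d (x \<otimes> y) (x \<otimes> z) = d y z"
  and right_invariant:
    "\<lbrakk>x \<in> carrier G; y \<in> carrier G; z \<in> carrier G\<rbrakk> \<Longrightarrow> d (y \<otimes> x) (z \<otimes> x) = d y z"

text \<open>Functions on a carrier set are represented extensionally (\<open>undefined\<close> outside it), so that
  two of them are equal exactly when they agree on the carrier.\<close>

definition katetov :: "'a set \<Rightarrow> ('a \<Rightarrow> 'a \<Rightarrow> real) \<Rightarrow> ('a \<Rightarrow> real) set" where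
  "katetov M d =
    {f \<in> extensional M. \<forall>x\<in>M. \<forall>y\<in>M. \<bar>f x - f y\<bar> \<le> d x y \<and> d x y \<le> f x + f y}"

definition delta :: "'a set \<Rightarrow> ('a \<Rightarrow> 'a \<Rightarrow> real) \<Rightarrow> 'a \<Rightarrow> 'a \<Rightarrow> real" where
  "delta M d x = (\<lambda>t\<in>M. d x t)"

text \<open>As for \<open>fdist\<close> in the library, the value \<open>0\<close> for arguments that are not both in the space is
  needed because \<open>Metric_space\<close> demands symmetry and nonnegativity of all arguments.\<close>

definition d_infty ::
    "'a set \<Rightarrow> ('a \<Rightarrow> 'a \<Rightarrow> real) \<Rightarrow> ('a \<Rightarrow> real) \<Rightarrow> ('a \<Rightarrow> real) \<Rightarrow> real" where
  "d_infty M d f g =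
    (if f \<in> katetov M d \<and> g \<in> katetov M d then (SUP x\<in>M. \<bar>f x - g x\<bar>) else 0)"

definition inf_convolution ::
    "('a, 'b) monoid_scheme \<Rightarrow> ('a \<Rightarrow> real) \<Rightarrow> ('a \<Rightarrow> real) \<Rightarrow> 'a \<Rightarrow> real" where
  "inf_convolution G f g =
    (\<lambda>x\<in>carrier G. Inf {f y + g z | y z. y \<in> carrier G \<and> z \<in> carrier G \<and> y \<otimes>\<^bsub>G\<^esub> z = x})"

definition katetov_monoid ::
    "('a, 'b) monoid_scheme \<Rightarrow> ('a \<Rightarrow> 'a \<Rightarrow> real) \<Rightarrow> ('a \<Rightarrow> real) monoid" where
  "katetov_monoid G d =
    \<lparr>carrier = katetov (carrier G) d,
     mult = inf_convolution G,
     one = delta (carrier G) d \<one>\<^bsub>G\<^esub>\<rparr>"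

text \<open>The supremum and the infimum above are finite, so \<open>Sup\<close> and \<open>Inf\<close> on the reals carry their
  intended meaning.\<close>

lemma (in Metric_space) bdd_above_d_infty:
  assumes f: "f \<in> katetov M d" and g: "g \<in> katetov M d"
  shows "bdd_above ((\<lambda>x. \<bar>f x - g x\<bar>) ` M)"
proof (cases "M = {}")
  case False
  then obtain a where a: "a \<in> M" by blast
  have "\<bar>f x - g x\<bar> \<le> f a + g a" if x: "x \<in> M" for x
  proof -
    have "\<bar>f x - f a\<bar> \<le> d x a" "d x a \<le> f x + f a"
      using f x a unfolding katetov_def by auto
    moreover have "\<bar>g x - g a\<bar> \<le> d x a" "d x a \<le> g x + g a"
      using g x a unfolding katetov_def by auto
    ultimately show ?thesis by linarith
  qed
  then show ?thesis by (intro bdd_aboveI2)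
qed simp

lemma (in Metric_space) katetov_nonneg:
  assumes f: "f \<in> katetov M d" and x: "x \<in> M"
  shows "0 \<le> f x"
proof -
  have "d x x \<le> f x + f x" using f x unfolding katetov_def by blast
  then show ?thesis using x by simp
qed

lemma (in metric_invariant_group) inf_convolution_set_nonempty_bdd_below:
  assumes f: "f \<in> katetov (carrier G) d" and g: "g \<in> katetov (carrier G) d"
    and x: "x \<in> carrier G"
  shows "{f y + g z | y z. y \<in> carrier G \<and> z \<in> carrier G \<and> y \<otimes> z = x} \<noteq> {}"
    and "bdd_below {f y + g z | y z. y \<in> carrier G \<and> z \<in> carrier G \<and> y \<otimes> z = x}"
proof -
  show "{f y + g z | y z. y \<in> carrier G \<and> z \<in> carrier G \<and> y \<otimes> z = x} \<noteq> {}"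
    using x l_one by blast
  show "bdd_below {f y + g z | y z. y \<in> carrier G \<and> z \<in> carrier G \<and> y \<otimes> z = x}"
    by (rule bdd_belowI[where m = 0])
       (auto intro!: add_nonneg_nonneg katetov_nonneg[OF f] katetov_nonneg[OF g])
qed

end

theory Submission
  imports Defs
begin

text \<open>By bi-invariance, multiplying one factor by a group element moves it as far as it moves the
  product, which makes an inf-convolution of Katetov maps 1-Lipschitz, and
  \<open>d (y \<otimes> z) (y' \<otimes> z') \<le> d y y' + d z z'\<close>, which gives the other Katetov inequality.
  Convolving with \<open>\<delta>\<^sub>x\<close> on either side is translation by \<open>inv x\<close>, hence isometric for the
  supremum metric, and the monoid laws pass to infima.\<close>

section \<open>Katetov maps and the supremum metric\<close>

lemma katetov_extensional: "f \<in> katetov M d \<Longrightarrow> f \<in> extensional M"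
  by (simp add: katetov_def)

lemma katetov_abs_diff_le:
  "\<lbrakk>f \<in> katetov M d; x \<in> M; y \<in> M\<rbrakk> \<Longrightarrow> \<bar>f x - f y\<bar> \<le> d x y"
  by (simp add: katetov_def)

lemma katetov_le_add:
  "\<lbrakk>f \<in> katetov M d; x \<in> M; y \<in> M\<rbrakk> \<Longrightarrow> f x \<le> f y + d x y"
  using katetov_abs_diff_le[of f M d x y] by linarith

lemma katetov_dist_le:
  "\<lbrakk>f \<in> katetov M d; x \<in> M; y \<in> M\<rbrakk> \<Longrightarrow> d x y \<le> f x + f y"
  by (simp add: katetov_def)

context Metric_space
begin

lemma delta_katetov:
  assumes a: "a \<in> M"
  shows "delta M d a \<in> katetov M d"
proof -
  have "\<bar>d a x - d a y\<bar> \<le> d x y \<and> d x y \<le> d a x + d a y" if "x \<in> M" "y \<in> M" for x y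
    using triangle[of a x y] triangle[of a y x] triangle[of x a y] commute[of x y] commute[of x a]
      a that by linarith
  then show ?thesis
    by (simp add: katetov_def delta_def)
qed

lemma abs_diff_le_d_infty:
  assumes "f \<in> katetov M d" "g \<in> katetov M d" "x \<in> M"
  shows "\<bar>f x - g x\<bar> \<le> d_infty M d f g"
  using assms cSUP_upper[OF _ bdd_above_d_infty] by (simp add: d_infty_def)

text \<open>\<open>M\<close> has to be nonempty because the supremum of the empty set of reals is an
  unspecified value.\<close>

lemma d_infty_le:
  assumes "M \<noteq> {}" "f \<in> katetov M d" "g \<in> katetov M d"
    and "\<And>x. x \<in> M \<Longrightarrow> \<bar>f x - g x\<bar> \<le> c"
  shows "d_infty M d f g \<le> c"
  using assms by (simp add: d_infty_def cSUP_least)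

lemma d_infty_commute: "d_infty M d f g = d_infty M d g f"
  by (simp add: d_infty_def abs_minus_commute conj_commute)

lemma d_infty_refl:
  assumes "M \<noteq> {}"
  shows "d_infty M d f f = 0"
  using assms by (simp add: d_infty_def)

lemma d_infty_nonneg:
  assumes "M \<noteq> {}"
  shows "0 \<le> d_infty M d f g"
proof (cases "f \<in> katetov M d \<and> g \<in> katetov M d")
  case True
  obtain a where "a \<in> M" using assms by blast
  then show ?thesis
    using True abs_diff_le_d_infty[of f g a] by linarith
next
  case False
  then show ?thesis by (auto simp: d_infty_def)
qed

text \<open>The metric axioms follow from the pointwise bounds of
  \<open>abs_diff_le_d_infty\<close>. Separation also uses that Katetov maps are extensional, so
  that agreement on \<open>M\<close> is equality of functions.\<close>

lemma Metric_space_d_infty: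
  assumes ne: "M \<noteq> {}"
  shows "Metric_space (katetov M d) (d_infty M d)"
proof
  show "0 \<le> d_infty M d f g" for f g
    by (rule d_infty_nonneg[OF ne])
  show "d_infty M d f g = d_infty M d g f" for f g
    by (rule d_infty_commute)
  show "d_infty M d f g = 0 \<longleftrightarrow> f = g"
    if f: "f \<in> katetov M d" and g: "g \<in> katetov M d" for f g
  proof
    assume "d_infty M d f g = 0"
    then have "f x = g x" if "x \<in> M" for x
      using abs_diff_le_d_infty[OF f g that] by simp
    then show "f = g"
      by (rule extensionalityI[OF katetov_extensional[OF f] katetov_extensional[OF g]])
  qed (simp add: d_infty_refl[OF ne])
  show "d_infty M d f h \<le> d_infty M d f g + d_infty M d g h"
    if f: "f \<in> katetov M d" and g: "g \<in> katetov M d" and h: "h \<in> katetov M d" for f g h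
  proof (rule d_infty_le[OF ne f h])
    fix x assume "x \<in> M"
    then show "\<bar>f x - h x\<bar> \<le> d_infty M d f g + d_infty M d g h"
      using abs_diff_le_d_infty[OF f g, of x] abs_diff_le_d_infty[OF g h, of x] by linarith
  qed
qed

end

section \<open>Algebra of the inf-convolution\<close>

lemma inf_convolution_extensional: "inf_convolution G f g \<in> extensional (carrier G)"
  by (simp add: inf_convolution_def)

context metric_invariant_group
begin

abbreviation (input) "KX \<equiv> katetov (carrier G) d"
abbreviation (input) "D \<equiv> d_infty (carrier G) d"
abbreviation (input) inf_conv (infixl "\<odot>" 70) where "f \<odot> g \<equiv> inf_convolution G f g"

text \<open>With \<open>inf_convolution_ge\<close>, this characterises the value as a greatest lower
  bound; the estimates below use these two facts instead of unfolding \<open>Inf\<close>.\<close>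

lemma inf_convolution_le:
  assumes "f \<in> KX" "g \<in> KX" "y \<in> carrier G" "z \<in> carrier G"
  shows "(f \<odot> g) (y \<otimes> z) \<le> f y + g z"
  using assms
  by (auto simp: inf_convolution_def
      intro!: cInf_lower inf_convolution_set_nonempty_bdd_below)

lemma inf_convolution_ge:
  assumes "f \<in> KX" "g \<in> KX" "x \<in> carrier G"
    and "\<And>y z. \<lbrakk>y \<in> carrier G; z \<in> carrier G; y \<otimes> z = x\<rbrakk> \<Longrightarrow> c \<le> f y + g z"
  shows "c \<le> (f \<odot> g) x"
proof -
  have "c \<le> Inf {f y + g z | y z. y \<in> carrier G \<and> z \<in> carrier G \<and> y \<otimes> z = x}"
    using assms(4)
    by (intro cInf_greatest[OF inf_convolution_set_nonempty_bdd_below(1)[OF assms(1-3)]]) blast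
  then show ?thesis
    using assms(3) by (simp add: inf_convolution_def)
qed

text \<open>The path through \<open>y' \<otimes> z\<close> changes one factor at a time: right
  invariance evaluates its first leg and left invariance the second.\<close>

lemma dist_mult_le:
  assumes "y \<in> carrier G" "z \<in> carrier G" "y' \<in> carrier G" "z' \<in> carrier G"
  shows "d (y \<otimes> z) (y' \<otimes> z') \<le> d y y' + d z z'"
  using triangle[of "y \<otimes> z" "y' \<otimes> z" "y' \<otimes> z'"] assms
  by (simp add: left_invariant right_invariant)

lemma inf_convolution_katetov:
  assumes f: "f \<in> KX" and g: "g \<in> KX"
  shows "f \<odot> g \<in> KX"
proof -
  have lip: "(f \<odot> g) x \<le> (f \<odot> g) x' + d x x'"
    if x: "x \<in> carrier G" and x': "x' \<in> carrier G" for x x'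
  proof -
    have "(f \<odot> g) x - d x x' \<le> f y + g z"
      if yz: "y \<in> carrier G" "z \<in> carrier G" "y \<otimes> z = x'" for y z
    proof -
      \<comment> \<open>To compare with a factorization \<open>y \<otimes> z = x'\<close>, keep
        \<open>y\<close> and change only the second factor: \<open>w\<close> is the one with
        \<open>y \<otimes> w = x\<close>. Left invariance then turns the distance of
        \<open>w\<close> and \<open>z\<close> into that of \<open>x\<close> and \<open>x'\<close>,
        and \<open>g\<close> is 1-Lipschitz.\<close>
      define w where "w = inv y \<otimes> x"
      have w: "w \<in> carrier G" "y \<otimes> w = x"
        using x yz by (simp_all add: w_def inv_solve_left' flip: m_assoc)
      have "d w z = d x x'"
        using left_invariant[of y w z] w yz by simp
      then show ?thesis
        using inf_convolution_le[OF f g yz(1) w(1)] katetov_le_add[OF g w(1) yz(2)] w(2)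
        by simp
    qed
    then have "(f \<odot> g) x - d x x' \<le> (f \<odot> g) x'"
      by (rule inf_convolution_ge[OF f g x'])
    then show ?thesis by simp
  qed
  have sum: "d x x' \<le> (f \<odot> g) x + (f \<odot> g) x'"
    if x: "x \<in> carrier G" and x': "x' \<in> carrier G" for x x'
  proof -
    \<comment> \<open>The two infima are handled in turn: first the factors of \<open>x'\<close> are
      fixed, then those of \<open>x\<close>. Moving the other summand to the left makes
      \<open>inf_convolution_ge\<close> applicable each time.\<close>
    have "d x x' - (f \<odot> g) x \<le> f y' + g z'"
      if yz': "y' \<in> carrier G" "z' \<in> carrier G" "y' \<otimes> z' = x'" for y' z'
    proof -
      have "d x x' - (f y' + g z') \<le> f y + g z"
        if yz: "y \<in> carrier G" "z \<in> carrier G" "y \<otimes> z = x" for y z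
        using dist_mult_le[OF yz(1,2) yz'(1,2)] katetov_dist_le[OF f yz(1) yz'(1)]
          katetov_dist_le[OF g yz(2) yz'(2)] yz(3) yz'(3) by simp
      then have "d x x' - (f y' + g z') \<le> (f \<odot> g) x"
        by (rule inf_convolution_ge[OF f g x])
      then show ?thesis by simp
    qed
    then have "d x x' - (f \<odot> g) x \<le> (f \<odot> g) x'"
      by (rule inf_convolution_ge[OF f g x'])
    then show ?thesis by simp
  qed
  have "\<bar>(f \<odot> g) x - (f \<odot> g) x'\<bar> \<le> d x x'" if "x \<in> carrier G" "x' \<in> carrier G" for x x'
    using lip[of x x'] lip[of x' x] that commute[of x x'] by linarith
  then show ?thesis
    using sum by (simp add: katetov_def inf_convolution_extensional)
qed

text \<open>Both sides are the infimum of \<open>f y + g u + h v\<close> over triples with product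
  \<open>x\<close>. In each direction the outer factorization is fixed and its summand outside the
  inner convolution is subtracted, so that the inner infimum can be bounded alone.\<close>

lemma inf_convolution_assoc:
  assumes f: "f \<in> KX" and g: "g \<in> KX" and h: "h \<in> KX"
  shows "f \<odot> g \<odot> h = f \<odot> (g \<odot> h)"
proof (rule extensionalityI[OF inf_convolution_extensional inf_convolution_extensional])
  fix x assume x: "x \<in> carrier G"
  note fg = inf_convolution_katetov[OF f g] and gh = inf_convolution_katetov[OF g h]
  show "(f \<odot> g \<odot> h) x = (f \<odot> (g \<odot> h)) x"
  proof (rule antisym)
    show "(f \<odot> g \<odot> h) x \<le> (f \<odot> (g \<odot> h)) x"
    proof (rule inf_convolution_ge[OF f gh x])
      fix y w assume yw: "y \<in> carrier G" "w \<in> carrier G" "y \<otimes> w = x"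
      have "(f \<odot> g \<odot> h) x - f y \<le> (g \<odot> h) w"
      proof (rule inf_convolution_ge[OF g h yw(2)])
        fix u v assume uv: "u \<in> carrier G" "v \<in> carrier G" "u \<otimes> v = w"
        have "y \<otimes> u \<otimes> v = x"
          using yw uv by (simp add: m_assoc)
        then show "(f \<odot> g \<odot> h) x - f y \<le> g u + h v"
          using inf_convolution_le[OF fg h, of "y \<otimes> u" v] inf_convolution_le[OF f g, of y u] yw uv
          by simp
      qed
      then show "(f \<odot> g \<odot> h) x \<le> f y + (g \<odot> h) w" by simp
    qed
    show "(f \<odot> (g \<odot> h)) x \<le> (f \<odot> g \<odot> h) x"
    proof (rule inf_convolution_ge[OF fg h x])
      fix w v assume wv: "w \<in> carrier G" "v \<in> carrier G" "w \<otimes> v = x"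
      have "(f \<odot> (g \<odot> h)) x - h v \<le> (f \<odot> g) w"
      proof (rule inf_convolution_ge[OF f g wv(1)])
        fix y u assume yu: "y \<in> carrier G" "u \<in> carrier G" "y \<otimes> u = w"
        have "y \<otimes> (u \<otimes> v) = x"
          using wv yu by (simp flip: m_assoc)
        then show "(f \<odot> (g \<odot> h)) x - h v \<le> f y + g u"
          using inf_convolution_le[OF f gh, of y "u \<otimes> v"] inf_convolution_le[OF g h, of u v] wv yu
          by simp
      qed
      then show "(f \<odot> (g \<odot> h)) x \<le> (f \<odot> g) w + h v" by simp
    qed
  qed
qed

text \<open>The factorization of \<open>t\<close> with first factor \<open>x\<close> attains the
  infimum, since \<open>d x x = 0\<close>. Any other one costs at least as much because
  \<open>f\<close> is 1-Lipschitz and \<open>inv x \<otimes> t\<close> is as far from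
  \<open>z\<close> as \<open>x\<close> is from \<open>y\<close>.\<close>

lemma delta_inf_convolution:
  assumes f: "f \<in> KX" and x: "x \<in> carrier G" and t: "t \<in> carrier G"
  shows "(delta (carrier G) d x \<odot> f) t = f (inv x \<otimes> t)"
proof (rule antisym)
  note dx = delta_katetov[OF x]
  have "x \<otimes> (inv x \<otimes> t) = t"
    using x t by (simp flip: m_assoc)
  then show "(delta (carrier G) d x \<odot> f) t \<le> f (inv x \<otimes> t)"
    using inf_convolution_le[OF dx f, of x "inv x \<otimes> t"] x t by (simp add: delta_def)
  show "f (inv x \<otimes> t) \<le> (delta (carrier G) d x \<odot> f) t"
  proof (rule inf_convolution_ge[OF dx f t])
    fix y z assume yz: "y \<in> carrier G" "z \<in> carrier G" "y \<otimes> z = t"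
    \<comment> \<open>Inserting \<open>inv x \<otimes> x\<close> before \<open>z\<close> gives both
      points the common right factor \<open>z\<close>, and then the common left factor
      \<open>inv x\<close>; invariance cancels them in this order.\<close>
    have "d (inv x \<otimes> t) z = d (inv x \<otimes> y \<otimes> z) (inv x \<otimes> x \<otimes> z)"
      using x yz by (simp add: m_assoc)
    also have "\<dots> = d (inv x \<otimes> y) (inv x \<otimes> x)"
      using x yz by (intro right_invariant) auto
    also have "\<dots> = d y x"
      using x yz by (intro left_invariant) auto
    also have "\<dots> = d x y"
      by (rule commute)
    finally show "f (inv x \<otimes> t) \<le> delta (carrier G) d x y + f z"
      using katetov_le_add[OF f, of "inv x \<otimes> t" z] x yz t by (simp add: delta_def)
  qed
qed

text \<open>Mirror image of \<open>delta_inf_convolution\<close>: left invariance now cancels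
  \<open>y\<close> first, and right invariance then cancels \<open>inv x\<close>.\<close>

lemma inf_convolution_delta:
  assumes f: "f \<in> KX" and x: "x \<in> carrier G" and t: "t \<in> carrier G"
  shows "(f \<odot> delta (carrier G) d x) t = f (t \<otimes> inv x)"
proof (rule antisym)
  note dx = delta_katetov[OF x]
  have "t \<otimes> inv x \<otimes> x = t"
    using x t by (simp add: m_assoc)
  then show "(f \<odot> delta (carrier G) d x) t \<le> f (t \<otimes> inv x)"
    using inf_convolution_le[OF f dx, of "t \<otimes> inv x" x] x t by (simp add: delta_def)
  show "f (t \<otimes> inv x) \<le> (f \<odot> delta (carrier G) d x) t"
  proof (rule inf_convolution_ge[OF f dx t])
    fix y z assume yz: "y \<in> carrier G" "z \<in> carrier G" "y \<otimes> z = t"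
    have "d (t \<otimes> inv x) y = d (y \<otimes> (z \<otimes> inv x)) (y \<otimes> (x \<otimes> inv x))"
      using x yz by (simp flip: m_assoc)
    also have "\<dots> = d (z \<otimes> inv x) (x \<otimes> inv x)"
      using x yz by (intro left_invariant) auto
    also have "\<dots> = d z x"
      using x yz by (intro right_invariant) auto
    also have "\<dots> = d x z"
      by (rule commute)
    finally show "f (t \<otimes> inv x) \<le> f y + delta (carrier G) d x z"
      using katetov_le_add[OF f, of "t \<otimes> inv x" y] x yz t by (simp add: delta_def)
  qed
qed

lemma delta_one_inf_convolution:
  assumes f: "f \<in> KX"
  shows "delta (carrier G) d \<one> \<odot> f = f"
  by (rule extensionalityI[OF inf_convolution_extensional katetov_extensional[OF f]])
    (simp add: delta_inf_convolution[OF f])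

lemma inf_convolution_delta_one:
  assumes f: "f \<in> KX"
  shows "f \<odot> delta (carrier G) d \<one> = f"
  by (rule extensionalityI[OF inf_convolution_extensional katetov_extensional[OF f]])
    (simp add: inf_convolution_delta[OF f])

section \<open>Metric estimates for the inf-convolution\<close>

lemma carrier_nonempty: "carrier G \<noteq> {}"
  using one_closed by blast

text \<open>Every sum \<open>f y + g z\<close> changes by at most the right-hand side, uniformly in
  the factorization, hence so does the infimum. Making one pair of arguments equal yields both
  inequalities of (a).\<close>

lemma d_infty_inf_convolution_le:
  assumes f: "f \<in> KX" and g: "g \<in> KX" and f': "f' \<in> KX" and g': "g' \<in> KX"
  shows "D (f \<odot> g) (f' \<odot> g') \<le> D f f' + D g g'"
proof (rule d_infty_le[OF carrier_nonempty
      inf_convolution_katetov[OF f g] inf_convolution_katetov[OF f' g']])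
  fix x assume x: "x \<in> carrier G"
  \<comment> \<open>Stated for arbitrary maps so that exchanging the two pairs gives the other half
    of the absolute value.\<close>
  have le: "(p \<odot> q) x \<le> (p' \<odot> q') x + (D p p' + D q q')"
    if p: "p \<in> KX" and q: "q \<in> KX" and p': "p' \<in> KX" and q': "q' \<in> KX" for p q p' q'
  proof -
    have "(p \<odot> q) x - (D p p' + D q q') \<le> p' y + q' z"
      if yz: "y \<in> carrier G" "z \<in> carrier G" "y \<otimes> z = x" for y z
      using inf_convolution_le[OF p q yz(1,2)] abs_diff_le_d_infty[OF p p' yz(1)]
        abs_diff_le_d_infty[OF q q' yz(2)] yz(3) by simp
    then have "(p \<odot> q) x - (D p p' + D q q') \<le> (p' \<odot> q') x"
      by (rule inf_convolution_ge[OF p' q' x])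
    then show ?thesis by simp
  qed
  show "\<bar>(f \<odot> g) x - (f' \<odot> g') x\<bar> \<le> D f f' + D g g'"
    using le[OF f g f' g'] le[OF f' g' f g] d_infty_commute[of f' f] d_infty_commute[of g' g]
    by linarith
qed

lemma d_infty_inf_convolution_right_le:
  assumes "f \<in> KX" "g \<in> KX" "h \<in> KX"
  shows "D (f \<odot> g) (h \<odot> g) \<le> D f h"
  using d_infty_inf_convolution_le[of f g h g] assms by (simp add: d_infty_refl[OF carrier_nonempty])

lemma d_infty_inf_convolution_left_le:
  assumes "f \<in> KX" "g \<in> KX" "h \<in> KX"
  shows "D (g \<odot> f) (g \<odot> h) \<le> D f h"
  using d_infty_inf_convolution_le[of g f g h] assms by (simp add: d_infty_refl[OF carrier_nonempty])

text \<open>One inequality is an instance of (a). For the other, the translated maps evaluated at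
  \<open>x \<otimes> t\<close> return \<open>f t\<close> and \<open>h t\<close>, so no pointwise
  difference is lost.\<close>

lemma d_infty_delta_inf_convolution:
  assumes f: "f \<in> KX" and h: "h \<in> KX" and x: "x \<in> carrier G"
  shows "D (delta (carrier G) d x \<odot> f) (delta (carrier G) d x \<odot> h) = D f h"
proof (rule antisym)
  note dx = delta_katetov[OF x]
  show "D (delta (carrier G) d x \<odot> f) (delta (carrier G) d x \<odot> h) \<le> D f h"
    by (rule d_infty_inf_convolution_left_le[OF f dx h])
  show "D f h \<le> D (delta (carrier G) d x \<odot> f) (delta (carrier G) d x \<odot> h)"
  proof (rule d_infty_le[OF carrier_nonempty f h])
    fix t assume t: "t \<in> carrier G"
    have "inv x \<otimes> (x \<otimes> t) = t"
      using x t by (simp flip: m_assoc)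
    then show "\<bar>f t - h t\<bar> \<le> D (delta (carrier G) d x \<odot> f) (delta (carrier G) d x \<odot> h)"
      using abs_diff_le_d_infty[OF inf_convolution_katetov[OF dx f] inf_convolution_katetov[OF dx h],
          of "x \<otimes> t"] x t
      by (simp add: delta_inf_convolution f h)
  qed
qed

lemma d_infty_inf_convolution_delta:
  assumes f: "f \<in> KX" and h: "h \<in> KX" and x: "x \<in> carrier G"
  shows "D (f \<odot> delta (carrier G) d x) (h \<odot> delta (carrier G) d x) = D f h"
proof (rule antisym)
  note dx = delta_katetov[OF x]
  show "D (f \<odot> delta (carrier G) d x) (h \<odot> delta (carrier G) d x) \<le> D f h"
    by (rule d_infty_inf_convolution_right_le[OF f dx h])
  show "D f h \<le> D (f \<odot> delta (carrier G) d x) (h \<odot> delta (carrier G) d x)"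
  proof (rule d_infty_le[OF carrier_nonempty f h])
    fix t assume t: "t \<in> carrier G"
    have "t \<otimes> x \<otimes> inv x = t"
      using x t by (simp add: m_assoc)
    then show "\<bar>f t - h t\<bar> \<le> D (f \<odot> delta (carrier G) d x) (h \<odot> delta (carrier G) d x)"
      using abs_diff_le_d_infty[OF inf_convolution_katetov[OF f dx] inf_convolution_katetov[OF h dx],
          of "t \<otimes> x"] x t
      by (simp add: inf_convolution_delta f h)
  qed
qed

section \<open>The monoid of Katetov maps\<close>

lemma monoid_katetov_monoid: "monoid (katetov_monoid G d)"
  by (rule monoidI)
    (simp_all add: katetov_monoid_def inf_convolution_katetov inf_convolution_assoc
      delta_katetov delta_one_inf_convolution inf_convolution_delta_one)

end

text \<open>In a commutative group, swapping the factors permutes the factorizations of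
  \<open>x\<close>, so both infima are taken over the same set.\<close>

lemma inf_convolution_commute:
  assumes "comm_group G"
  shows "inf_convolution G f g = inf_convolution G g f"
proof -
  interpret comm_group G by fact
  have "{f y + g z | y z. y \<in> carrier G \<and> z \<in> carrier G \<and> y \<otimes>\<^bsub>G\<^esub> z = x}
      = {g y + f z | y z. y \<in> carrier G \<and> z \<in> carrier G \<and> y \<otimes>\<^bsub>G\<^esub> z = x}" for x
    using m_comm by (auto simp: add.commute; metis add.commute)
  then show ?thesis
    by (simp add: inf_convolution_def)
qed

theorem proposition5:
  fixes G :: "('a, 'b) monoid_scheme" and d :: "'a \<Rightarrow> 'a \<Rightarrow> real"
  assumes "metric_invariant_group G d"
  defines "X \<equiv> carrier G"
  defines "K \<equiv> katetov_monoid G d"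
  shows "Metric_space (carrier K) (d_infty X d) \<and>
    monoid K \<and>
    (comm_group G \<longrightarrow> comm_monoid K) \<and>
    \<one>\<^bsub>K\<^esub> = delta X d \<one>\<^bsub>G\<^esub> \<and>
    (\<forall>f\<in>carrier K. \<forall>g\<in>carrier K. \<forall>h\<in>carrier K.
       d_infty X d (f \<otimes>\<^bsub>K\<^esub> g) (h \<otimes>\<^bsub>K\<^esub> g) \<le> d_infty X d f h \<and>
       d_infty X d (g \<otimes>\<^bsub>K\<^esub> f) (g \<otimes>\<^bsub>K\<^esub> h) \<le> d_infty X d f h) \<and>
    (\<forall>f\<in>carrier K. \<forall>h\<in>carrier K. \<forall>x\<in>X.
       d_infty X d (delta X d x \<otimes>\<^bsub>K\<^esub> f) (delta X d x \<otimes>\<^bsub>K\<^esub> h) = d_infty X d f h \<and>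
       d_infty X d (f \<otimes>\<^bsub>K\<^esub> delta X d x) (h \<otimes>\<^bsub>K\<^esub> delta X d x) = d_infty X d f h)"
proof -
  interpret metric_invariant_group G d by fact
  interpret K: monoid K
    unfolding K_def by (rule monoid_katetov_monoid)
  have K_simps: "carrier K = katetov (carrier G) d" "mult K = inf_convolution G"
    "\<one>\<^bsub>K\<^esub> = delta (carrier G) d \<one>\<^bsub>G\<^esub>"
    by (simp_all add: K_def katetov_monoid_def)
  have "comm_monoid K" if "comm_group G"
    by (rule K.monoid_comm_monoidI) (simp add: K_simps inf_convolution_commute[OF that])
  then show ?thesis
    unfolding X_def
    using Metric_space_d_infty[OF carrier_nonempty] K.monoid_axioms
      d_infty_inf_convolution_right_le d_infty_inf_convolution_left_le
      d_infty_delta_inf_convolution d_infty_inf_convolution_delta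
    by (simp add: K_simps)
qed

end
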